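(* Let $A$ and $B$ be irreducible, non-permutation square matrices with entries in $\{0,1\}$ (of sizes greater than $1$). If the one-sided topological Markov shifts $(X_A,\sigma_A)$ and $(X_B,\sigma_B)$ are strongly continuously orbit equivalent, then $h_{top}(\sigma_A)=h_{top}(\sigma_B)$, where $h_{top}$ denotes topological entropy.
   Context: For an $N\times N$ matrix $A$ with entries in $\{0,1\}$, $N>1$, $X_A$ is the compact space of sequences $(x_n)_{n\in\mathbb{N}}\in\{1,\dots,N\}^{\mathbb{N}}$ with $A(x_n,x_{n+1})=1$ for all $n$ (subspace of the product topology), and $\sigma_A:X_A\to X_A$, $\sigma_A((x_n)_n)=(x_{n+1})_n$. Continuous orbit equivalence. $(X_A,\sigma_A)$ and $(X_B,\sigma_B)$ are continuously orbit equivalent via a homeomorphism $h:X_A\to X_B$ if there are continuous functions $k_1,l_1:X_A\to\mathbb{Z}_+$, $k_2,l_2:X_B\to\mathbb{Z}_+$ ($\mathbb{Z}_+=\{0,1,2,\dots\}$) with $$\sigma_B^{k_1(x)}(h(\sigma_A(x)))=\sigma_B^{l_1(x)}(h(x))\ (x\in X_A),\qquad \sigma_A^{k_2(y)}(h^{-1}(\sigma_B(y)))=\sigma_A^{l_2(y)}(h^{-1}(y))\ (y\in X_B).$$ The cocycle function for $h$ is $c_1=l_1-k_1\in C(X_A,\mathbb{Z})$. Strong continuous orbit equivalence. $(X_A,\sigma_A)$ and $(X_B,\sigma_B)$ are strongly continuously orbit equivalent if they are continuously orbit equivalent via some homeomorphism $h:X_A\to X_B$ whose cocycle function $c_1$ satisfies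 $c_1(x)=1+b_1(x)-b_1(\sigma_A(x))$ for all $x\in X_A$, for some continuous function $b_1:X_A\to\mathbb{Z}$. *)

theory Defs
  imports "HOL-Analysis.Analysis"
begin

section \<open>Matrices with entries in $\{0,1\}$\<close>

definition zero_one_matrix :: "nat^'n^'n \<Rightarrow> bool" where
  "zero_one_matrix A \<longleftrightarrow> (\<forall>i j. A $ i $ j \<in> {0, 1})"

definition matrix_power :: "nat^'n^'n \<Rightarrow> nat \<Rightarrow> nat^'n^'n" where
  "matrix_power A n = (((**) A) ^^ n) (mat 1)"

definition irreducible_matrix :: "nat^'n^'n \<Rightarrow> bool" where
  "irreducible_matrix A \<longleftrightarrow> (\<forall>i j. \<exists>n>0. matrix_power A n $ i $ j > 0)"

definition permutation_matrix :: "nat^'n^'n \<Rightarrow> bool" where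
  "permutation_matrix A \<longleftrightarrow> (\<exists>p. bij p \<and> A = (\<chi> i j. if j = p i then 1 else 0))"


section \<open>One-sided topological Markov shifts\<close>

definition markov_sequences :: "nat^'n^'n \<Rightarrow> (nat \<Rightarrow> 'n) set" where
  "markov_sequences A = {x. \<forall>n. A $ x n $ x (Suc n) = 1}"

definition markov_space :: "nat^'n^'n \<Rightarrow> (nat \<Rightarrow> 'n) topology" where
  "markov_space A =
     subtopology (product_topology (\<lambda>_. discrete_topology UNIV) UNIV) (markov_sequences A)"

definition shift :: "(nat \<Rightarrow> 'n) \<Rightarrow> nat \<Rightarrow> 'n" where
  "shift x = (\<lambda>n. x (Suc n))"


section \<open>Continuous orbit equivalence\<close>

text \<open>In \<open>coe_via\<close>, the map \<open>g\<close> plays the role of the inverse homeomorphism of \<open>h\<close>.\<close>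

definition coe_via ::
  "nat^'n^'n \<Rightarrow> nat^'m^'m
    \<Rightarrow> ((nat \<Rightarrow> 'n) \<Rightarrow> nat \<Rightarrow> 'm) \<Rightarrow> ((nat \<Rightarrow> 'm) \<Rightarrow> nat \<Rightarrow> 'n)
    \<Rightarrow> ((nat \<Rightarrow> 'n) \<Rightarrow> nat) \<Rightarrow> ((nat \<Rightarrow> 'n) \<Rightarrow> nat)
    \<Rightarrow> ((nat \<Rightarrow> 'm) \<Rightarrow> nat) \<Rightarrow> ((nat \<Rightarrow> 'm) \<Rightarrow> nat) \<Rightarrow> bool" where
  "coe_via A B h g k1 l1 k2 l2 \<longleftrightarrow>
     homeomorphic_maps (markov_space A) (markov_space B) h g \<and>
     continuous_map (markov_space A) (discrete_topology UNIV) k1 \<and>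
     continuous_map (markov_space A) (discrete_topology UNIV) l1 \<and>
     continuous_map (markov_space B) (discrete_topology UNIV) k2 \<and>
     continuous_map (markov_space B) (discrete_topology UNIV) l2 \<and>
     (\<forall>x \<in> markov_sequences A. (shift ^^ k1 x) (h (shift x)) = (shift ^^ l1 x) (h x)) \<and>
     (\<forall>y \<in> markov_sequences B. (shift ^^ k2 y) (g (shift y)) = (shift ^^ l2 y) (g y))"

definition cocycle :: "('a \<Rightarrow> nat) \<Rightarrow> ('a \<Rightarrow> nat) \<Rightarrow> 'a \<Rightarrow> int" where
  "cocycle k1 l1 x = int (l1 x) - int (k1 x)"

definition strongly_continuously_orbit_equivalent ::
  "nat^'n^'n \<Rightarrow> nat^'m^'m \<Rightarrow> bool" where
  "strongly_continuously_orbit_equivalent A B \<longleftrightarrow>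
     (\<exists>h g k1 l1 k2 l2. coe_via A B h g k1 l1 k2 l2 \<and>
        (\<exists>b1 :: (nat \<Rightarrow> 'n) \<Rightarrow> int.
           continuous_map (markov_space A) (discrete_topology UNIV) b1 \<and>
           (\<forall>x \<in> markov_sequences A. cocycle k1 l1 x = 1 + b1 x - b1 (shift x))))"


section \<open>Topological entropy\<close>

text \<open>Topological entropy of a continuous self-map \<open>T\<close> of a compact space \<open>X\<close>, defined by open
  covers following Adler, Konheim and McAndrew.\<close>

definition open_cover :: "'a topology \<Rightarrow> 'a set set \<Rightarrow> bool" where
  "open_cover X \<U> \<longleftrightarrow> (\<forall>U\<in>\<U>. openin X U) \<and> \<Union>\<U> = topspace X"

text \<open>The least cardinality of a subcover; meaningful when a finite subcover exists.\<close>

definition cover_number :: "'a topology \<Rightarrow> 'a set set \<Rightarrow> nat" where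
  "cover_number X \<U> = (LEAST k. \<exists>\<V>\<subseteq>\<U>. finite \<V> \<and> \<Union>\<V> = topspace X \<and> card \<V> = k)"

text \<open>The common refinement $\mathcal U \vee T^{-1}\mathcal U \vee \dots \vee T^{-(n-1)}\mathcal U$.\<close>

definition iterated_join :: "'a topology \<Rightarrow> ('a \<Rightarrow> 'a) \<Rightarrow> 'a set set \<Rightarrow> nat \<Rightarrow> 'a set set" where
  "iterated_join X T \<U> n =
     {{x \<in> topspace X. \<forall>i<n. (T ^^ i) x \<in> c i} | c. \<forall>i<n. c i \<in> \<U>}"

text \<open>The \<open>limsup\<close> is a limit, because the logarithms of the cover numbers are subadditive in \<open>n\<close>.\<close>

definition cover_entropy :: "'a topology \<Rightarrow> ('a \<Rightarrow> 'a) \<Rightarrow> 'a set set \<Rightarrow> ereal" where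
  "cover_entropy X T \<U> =
     limsup (\<lambda>n. ereal (ln (real (cover_number X (iterated_join X T \<U> n))) / real n))"

definition topological_entropy :: "'a topology \<Rightarrow> ('a \<Rightarrow> 'a) \<Rightarrow> ereal" where
  "topological_entropy X T = (SUP \<U> \<in> {\<U>. open_cover X \<U>}. cover_entropy X T \<U>)"

end

theory Submission
  imports Defs
begin

text \<open>For a constant \<open>K\<close> bounding \<open>k1 + \<bar>b1\<bar>\<close>, put \<open>t x = K + b1 x\<close> and
  \<open>\<phi> x = (shift ^^ t x) (h x)\<close>. The identity \<open>l1 - k1 = 1 + b1 - b1 \<circ> shift\<close> turns the orbit
  equation into the exact semiconjugacy \<open>\<phi> \<circ> shift = shift \<circ> \<phi>\<close>. As \<open>t\<close> is bounded and the shift of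
  an irreducible matrix is onto, \<open>\<phi>\<close> is onto; as \<open>h x\<close> is recovered from \<open>\<phi> x\<close> and boundedly many
  symbols, \<open>\<phi>\<close> is bounded-to-one. Such a factor map preserves entropy, which for
  Markov shifts is the exponential growth rate of the number of words.\<close>

section \<open>Prefixes, words and counting by codings\<close>

definition prefix :: "nat \<Rightarrow> (nat \<Rightarrow> 'a) \<Rightarrow> 'a list" where
  "prefix n x = map x [0..<n]"

text \<open>Words are prefixes of points, not finite paths in the graph of \<open>A\<close>; thus
  each of them extends to an infinite sequence, and counting words means counting values of a map on
  \<open>markov_sequences A\<close>.\<close>

definition words :: "nat^'n^'n \<Rightarrow> nat \<Rightarrow> 'n list set" where
  "words A n = prefix n ` markov_sequences A"

lemma prefix_eq_iff: "prefix n x = prefix n y \<longleftrightarrow> (\<forall>i<n. x i = y i)"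
  by (auto simp: prefix_def)

lemma prefix_eq_mono: "prefix n x = prefix n y \<Longrightarrow> m \<le> n \<Longrightarrow> prefix m x = prefix m y"
  by (auto simp: prefix_eq_iff)

lemma finite_lists_of_length: "finite {xs :: 'a::finite list. length xs = n}"
  using finite_lists_length_eq[of "UNIV :: 'a set" n] by simp

lemma card_lists_of_length: "card {xs :: 'a::finite list. length xs = n} = CARD('a) ^ n"
  using card_lists_length_eq[of "UNIV :: 'a set" n] by simp

lemma finite_words: "finite (words A n)"
  by (rule finite_subset[OF _ finite_lists_of_length[of n]]) (auto simp: words_def prefix_def)

lemma shift_funpow: "(shift ^^ i) x = (\<lambda>n. x (n + i))"
  by (induction i) (auto simp: shift_def)

lemma shift_funpow_markov_sequences:
  "x \<in> markov_sequences A \<Longrightarrow> (shift ^^ i) x \<in> markov_sequences A"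
  by (auto simp: markov_sequences_def shift_funpow)

lemma shift_markov_sequences: "x \<in> markov_sequences A \<Longrightarrow> shift x \<in> markov_sequences A"
  using shift_funpow_markov_sequences[of x A 1] by simp

text \<open>On \<open>X\<close> the map \<open>f\<close> factors through \<open>g\<close>. The word
  counts are compared by this principle: \<open>f\<close> and \<open>g\<close> are two finite
  codings of the same points.\<close>

lemma card_image_le_if_determined:
  assumes "finite (g ` X)" "\<And>x y. x \<in> X \<Longrightarrow> y \<in> X \<Longrightarrow> g x = g y \<Longrightarrow> f x = f y"
  shows "finite (f ` X) \<and> card (f ` X) \<le> card (g ` X)"
proof -
  have "f ` X = (\<lambda>z. f (inv_into X g z)) ` g ` X"
  proof -
    have "f x = f (inv_into X g (g x))" if "x \<in> X" for x
      by (rule assms(2)) (use that in \<open>auto simp: f_inv_into_f inv_into_into\<close>)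
    then show ?thesis
      by (auto simp: image_image)
  qed
  then show ?thesis
    using assms(1) by (metis card_image_le finite_imageI)
qed

section \<open>Topology of Markov spaces\<close>

lemma topspace_markov_space [simp]: "topspace (markov_space A) = markov_sequences A"
  by (simp add: markov_space_def)

lemma continuous_map_coordinate:
  "continuous_map (markov_space A) (discrete_topology UNIV) (\<lambda>x. x i)"
  unfolding markov_space_def
  by (intro continuous_map_from_subtopology continuous_map_product_projection) simp

lemma openin_cylinder:
  fixes A :: "nat^'n^'n"
  assumes "x \<in> markov_sequences A"
  shows "openin (markov_space A) {y \<in> markov_sequences A. prefix n y = prefix n x}"
proof -
  have "{y \<in> markov_sequences A. prefix n y = prefix n x} =
    (\<Inter>i<n. {y \<in> topspace (markov_space A). y i \<in> {x i}}) \<inter> topspace (markov_space A)"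
    by (auto simp: prefix_eq_iff)
  also have "openin (markov_space A) \<dots>"
    by (intro openin_INT openin_continuous_map_preimage[OF continuous_map_coordinate]) auto
  finally show ?thesis .
qed

text \<open>Each transition condition involves two coordinates and is therefore closed; the
  intersection of these conditions is closed in a product of finite discrete spaces, which is
  compact by Tychonoff.\<close>

lemma compact_space_markov_space: "compact_space (markov_space (A :: nat^'n^'n))"
proof -
  let ?P = "product_topology (\<lambda>_::nat. discrete_topology (UNIV :: 'n set)) UNIV"
  have cont: "continuous_map ?P (discrete_topology UNIV) (\<lambda>x. (x n, x (Suc n)))" for n
  proof -
    have "continuous_map ?P (prod_topology (discrete_topology UNIV) (discrete_topology UNIV))
        (\<lambda>x. (x n, x (Suc n)))"
      by (intro continuous_map_pairedI continuous_map_product_projection) auto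
    then show ?thesis
      by (simp add: prod_topology_discrete_topology[symmetric])
  qed
  have "closedin ?P (\<Inter>n. {x \<in> topspace ?P. (x n, x (Suc n)) \<in> {(a, b). A $ a $ b = 1}})"
    by (intro closedin_INT closedin_continuous_map_preimage[OF cont]) auto
  also have "(\<Inter>n. {x \<in> topspace ?P. (x n, x (Suc n)) \<in> {(a, b). A $ a $ b = 1}}) =
      markov_sequences A"
    by (auto simp: markov_sequences_def)
  finally have "closedin ?P (markov_sequences A)" .
  moreover have "compact_space ?P"
    by (simp add: compact_space_product_topology compact_space_discrete_topology)
  ultimately show ?thesis
    unfolding markov_space_def by (intro compact_space_subtopology closedin_compact_space)
qed

text \<open>A basic open set of the product restricts finitely many coordinates, so a prefix that
  reaches past all of them suffices.\<close>

lemma openin_markov_space_cylinder: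
  assumes "openin (markov_space A) U" "x \<in> U"
  shows "\<exists>n. \<forall>y\<in>markov_sequences A. prefix n y = prefix n x \<longrightarrow> y \<in> U"
proof -
  obtain S where S: "openin (product_topology (\<lambda>_. discrete_topology UNIV) UNIV) S"
      "U = S \<inter> markov_sequences A"
    using assms(1) unfolding markov_space_def openin_subtopology by blast
  obtain V where V: "finite {i. V i \<noteq> UNIV}" "x \<in> Pi\<^sub>E UNIV V" "Pi\<^sub>E UNIV V \<subseteq> S"
    using S assms(2) unfolding openin_product_topology_alt by auto
  obtain n where n: "\<And>i. V i \<noteq> UNIV \<Longrightarrow> i < n"
    using V(1) finite_nat_set_iff_bounded by auto
  have "y \<in> S" if "prefix n y = prefix n x" for y
  proof -
    have "y i \<in> V i" for i
      using that V(2) n[of i] by (cases "V i = UNIV") (auto simp: prefix_eq_iff PiE_iff)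
    then show ?thesis
      using V(3) by (auto simp: PiE_iff)
  qed
  then show ?thesis
    using S by auto
qed

text \<open>This is Lebesgue's number lemma with prefix length in place of distance: by compactness
  finitely many cylinders, each inside a member of the cover, suffice, and their greatest length
  serves all points.\<close>

lemma open_cover_lebesgue_number:
  assumes "open_cover (markov_space A) \<U>"
  shows "\<exists>r. \<forall>x\<in>markov_sequences A. \<exists>U\<in>\<U>.
           \<forall>y\<in>markov_sequences A. prefix r y = prefix r x \<longrightarrow> y \<in> U"
proof -
  let ?X = "markov_sequences A"
  have "\<exists>U n. U \<in> \<U> \<and> (\<forall>y\<in>?X. prefix n y = prefix n x \<longrightarrow> y \<in> U)" if "x \<in> ?X" for x
  proof -
    obtain U where "U \<in> \<U>" "x \<in> U"
      using assms \<open>x \<in> ?X\<close> unfolding open_cover_def topspace_markov_space by blast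
    then show ?thesis
      using openin_markov_space_cylinder assms unfolding open_cover_def by metis
  qed
  then obtain U n where U: "\<And>x. x \<in> ?X \<Longrightarrow> U x \<in> \<U>"
    and n: "\<And>x y. x \<in> ?X \<Longrightarrow> y \<in> ?X \<Longrightarrow> prefix (n x) y = prefix (n x) x \<Longrightarrow> y \<in> U x"
    by metis
  define C where "C x = {y \<in> ?X. prefix (n x) y = prefix (n x) x}" for x
  have "\<exists>\<F>. finite \<F> \<and> \<F> \<subseteq> C ` ?X \<and> topspace (markov_space A) \<subseteq> \<Union>\<F>"
    using compact_space_markov_space[of A] unfolding compact_space_alt
  proof (rule allE[where x = "C ` ?X"], elim impE)
    show "(\<forall>U\<in>C ` ?X. openin (markov_space A) U) \<and> topspace (markov_space A) \<subseteq> \<Union> (C ` ?X)"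
      by (auto simp: C_def intro: openin_cylinder)
  qed auto
  then obtain F where F: "finite F" "F \<subseteq> ?X" "?X \<subseteq> \<Union> (C ` F)"
    by (metis finite_subset_image topspace_markov_space)
  obtain r where r: "\<And>x. x \<in> F \<Longrightarrow> n x \<le> r"
    using finite_nat_set_iff_bounded_le[of "n ` F"] F(1) by auto
  have "\<exists>U\<in>\<U>. \<forall>y\<in>?X. prefix r y = prefix r x \<longrightarrow> y \<in> U" if "x \<in> ?X" for x
  proof -
    obtain z where z: "z \<in> F" "x \<in> C z"
      using F(3) \<open>x \<in> ?X\<close> by auto
    have "y \<in> U z" if "y \<in> ?X" "prefix r y = prefix r x" for y
      using n[of z y] that z F(2) prefix_eq_mono[OF that(2) r[OF z(1)]] by (auto simp: C_def)
    then show ?thesis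
      using U z F(2) by blast
  qed
  then show ?thesis
    by blast
qed

text \<open>The fibres of \<open>f\<close> are open because the target is discrete; the Lebesgue
  number of the cover by fibres is the required length.\<close>

lemma continuous_map_discrete_uniform:
  fixes f :: "(nat \<Rightarrow> 'n::finite) \<Rightarrow> 'b"
  assumes "continuous_map (markov_space A) (discrete_topology UNIV) f"
  shows "\<exists>s. \<forall>x\<in>markov_sequences A. \<forall>y\<in>markov_sequences A.
           prefix s x = prefix s y \<longrightarrow> f x = f y"
proof -
  let ?X = "markov_sequences A"
  have "open_cover (markov_space A) (range (\<lambda>b. {x \<in> topspace (markov_space A). f x \<in> {b}}))"
    unfolding open_cover_def
    using openin_continuous_map_preimage[OF assms, of "{_}"] by auto
  from open_cover_lebesgue_number[OF this] obtain s where
    s: "\<forall>x\<in>?X. \<exists>b. \<forall>y\<in>?X. prefix s y = prefix s x \<longrightarrow> f y = b"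
    by auto
  show ?thesis
    using s by (intro exI[of _ s]) blast
qed

lemma continuous_map_discrete_finite_image:
  assumes "continuous_map (markov_space A) (discrete_topology UNIV) f"
  shows "finite (f ` markov_sequences A)"
  using image_compactin[OF compact_space_markov_space[of A, unfolded compact_space_def] assms]
  by (simp add: compactin_discrete_topology)

text \<open>Each coordinate of \<open>h\<close> is a discrete-valued continuous map; the
  \<open>p\<close> coordinates concerned have a common modulus.\<close>

lemma continuous_map_markov_space_uniform:
  assumes "continuous_map (markov_space A) (markov_space B) h"
  shows "\<exists>s. \<forall>x\<in>markov_sequences A. \<forall>y\<in>markov_sequences A.
           prefix s x = prefix s y \<longrightarrow> prefix p (h x) = prefix p (h y)"
proof -
  have "\<exists>s. \<forall>x\<in>markov_sequences A. \<forall>y\<in>markov_sequences A.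
      prefix s x = prefix s y \<longrightarrow> h x i = h y i" for i
    using continuous_map_compose[OF assms continuous_map_coordinate[of B i]]
    by (intro continuous_map_discrete_uniform) (simp add: o_def)
  then obtain s where s: "\<And>i x y. x \<in> markov_sequences A \<Longrightarrow> y \<in> markov_sequences A \<Longrightarrow>
      prefix (s i) x = prefix (s i) y \<Longrightarrow> h x i = h y i"
    by metis
  obtain r where r: "\<And>i. i < p \<Longrightarrow> s i \<le> r"
    using finite_nat_set_iff_bounded_le[of "s ` {..<p}"] by auto
  show ?thesis
  proof (intro exI[of _ r] ballI impI)
    fix x y assume xy: "x \<in> markov_sequences A" "y \<in> markov_sequences A"
      and "prefix r x = prefix r y"
    then show "prefix p (h x) = prefix p (h y)"
      unfolding prefix_eq_iff[of p] using s[OF xy] prefix_eq_mono r by blast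
  qed
qed

section \<open>Entropy as the growth rate of words\<close>

definition word_entropy :: "nat^'n^'n \<Rightarrow> ereal" where
  "word_entropy A = limsup (\<lambda>n. ereal (ln (real (card (words A n))) / real n))"

section \<open>Comparison of exponential growth rates\<close>

lemma ln_real_mono: "a \<le> b \<Longrightarrow> ln (real a) \<le> ln (real b)" for a b :: nat
  by (cases "a = 0"; cases "b = 0") auto

lemma ln_real_le_mult:
  fixes a b c :: nat
  assumes "a \<le> b * c" "c \<ge> 1"
  shows "ln (real a) \<le> ln (real b) + ln (real c)"
proof (cases "b = 0")
  case False
  then show ?thesis
    using ln_real_mono[OF assms(1)] assms(2) by (simp add: ln_mult)
qed (use assms in auto)

text \<open>After taking logarithms and dividing by \<open>n\<close>, the factor \<open>C\<close>
  vanishes in the limit and \<open>D ^ (n div p)\<close> contributes at most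
  \<open>ln D / p\<close>. With \<open>D = 1\<close> the error is zero; with \<open>D\<close> fixed
  and \<open>p\<close> large it is arbitrarily small.\<close>

lemma limsup_ln_growth_le:
  fixes a b :: "nat \<Rightarrow> nat" and C D p :: nat
  assumes "\<And>n. a n \<le> b n * (C * D ^ (n div p))" "C \<ge> 1" "D \<ge> 1" "p \<ge> 1"
  shows "limsup (\<lambda>n. ereal (ln (real (a n)) / real n)) \<le>
         limsup (\<lambda>n. ereal (ln (real (b n)) / real n)) + ereal (ln D / p)"
proof -
  have bound: "ln (real (a n)) / real n \<le> (ln C / n + ln D / p) + ln (real (b n)) / real n"
    if "n \<ge> 1" for n
  proof -
    have "real (n div p) \<le> real n / real p"
      by (rule of_nat_div_le_of_nat)
    then have "real (n div p) * ln D \<le> real n / p * ln D"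
      using assms by (intro mult_right_mono) auto
    moreover have "ln (real (a n)) \<le> ln (real (b n)) + ln (real (C * D ^ (n div p)))"
      using assms by (intro ln_real_le_mult) (auto simp: Suc_le_eq)
    moreover have "ln (real (C * D ^ (n div p))) = ln C + real (n div p) * ln D"
      using assms by (simp add: ln_mult ln_realpow)
    ultimately have "ln (real (a n)) \<le> ln (real (b n)) + ln C + real n / p * ln D"
      by linarith
    then have "ln (real (a n)) / n \<le> (ln (real (b n)) + ln C + real n / p * ln D) / n"
      by (rule divide_right_mono) simp
    also have "\<dots> = (ln C / n + ln D / p) + ln (real (b n)) / real n"
      using that by (simp add: add_divide_distrib)
    finally show ?thesis .
  qed
  have "(\<lambda>n. ln C / real n) \<longlonglongrightarrow> 0"
    by (rule lim_const_over_n)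
  then have "(\<lambda>n. ln C / real n + ln D / p) \<longlonglongrightarrow> 0 + ln D / p"
    by (intro tendsto_add tendsto_const)
  then have lim: "(\<lambda>n. ereal (ln C / real n + ln D / p)) \<longlonglongrightarrow> ereal (ln D / p)"
    by simp
  have "limsup (\<lambda>n. ereal (ln (real (a n)) / real n)) \<le>
      limsup (\<lambda>n. ereal (ln C / n + ln D / p) + ereal (ln (real (b n)) / real n))"
    by (intro Limsup_mono eventually_sequentiallyI[of 1]) (simp add: bound)
  also have "\<dots> = ereal (ln D / p) + limsup (\<lambda>n. ereal (ln (real (b n)) / real n))"
    by (rule ereal_limsup_lim_add[OF lim]) simp
  finally show ?thesis
    by (simp add: add.commute)
qed

section \<open>Cover numbers of iterated joins against word counts\<close>

lemma card_words_add_le: "card (words A (n + s)) \<le> card (words A n) * CARD('n) ^ s"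
  for A :: "nat^'n^'n"
proof -
  let ?g = "\<lambda>x. (prefix n x, prefix s ((shift ^^ n) x))"
  have sub: "?g ` markov_sequences A \<subseteq> words A n \<times> {xs. length xs = s}"
    by (auto simp: words_def prefix_def)
  have fin: "finite (words A n \<times> {xs :: 'n list. length xs = s})"
    by (intro finite_cartesian_product finite_words finite_lists_of_length)
  have "prefix (n + s) x = prefix (n + s) y" if "?g x = ?g y" for x y
    unfolding prefix_eq_iff
  proof (intro allI impI)
    fix i assume "i < n + s"
    show "x i = y i"
    proof (cases "i < n")
      case False
      then have "i - n < s" "i - n + n = i" using \<open>i < n + s\<close> by auto
      then show ?thesis
        using that by (auto simp: prefix_eq_iff shift_funpow)
    qed (use that in \<open>auto simp: prefix_eq_iff\<close>)
  qed
  then have "card (words A (n + s)) \<le> card (?g ` markov_sequences A)"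
    unfolding words_def using finite_subset[OF sub fin]
    by (intro card_image_le_if_determined[THEN conjunct2]) blast+
  also have "\<dots> \<le> card (words A n \<times> {xs :: 'n list. length xs = s})"
    by (rule card_mono[OF fin sub])
  also have "\<dots> = card (words A n) * CARD('n) ^ s"
    by (simp add: card_cartesian_product card_lists_of_length)
  finally show ?thesis .
qed

text \<open>If \<open>r\<close> is a Lebesgue number of the cover, a word of length
  \<open>n + r\<close> shows the first \<open>r\<close> symbols of each of the iterates
  \<open>i < n\<close>. It thereby selects one member of the join, and these members already
  cover.\<close>

lemma iterated_join_finite_subcover:
  fixes A :: "nat^'n^'n"
  assumes "open_cover (markov_space A) \<U>"
  shows "\<exists>r. \<forall>n. \<exists>\<V>\<subseteq>iterated_join (markov_space A) shift \<U> n.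
           finite \<V> \<and> \<Union>\<V> = topspace (markov_space A) \<and> card \<V> \<le> card (words A (n + r))"
proof -
  let ?X = "markov_sequences A"
  obtain r where r: "\<And>x. x \<in> ?X \<Longrightarrow> \<exists>U\<in>\<U>. \<forall>y\<in>?X. prefix r y = prefix r x \<longrightarrow> y \<in> U"
    using open_cover_lebesgue_number[OF assms] by blast
  \<comment> \<open>The member is chosen from the word rather than from the point, so that
    \<open>E n x\<close> depends only on finitely many symbols of \<open>x\<close>.\<close>
  define d where "d w = (SOME U. U \<in> \<U> \<and> (\<forall>y\<in>?X. prefix r y = w \<longrightarrow> y \<in> U))" for w
  have d: "d (prefix r x) \<in> \<U> \<and> (\<forall>y\<in>?X. prefix r y = prefix r x \<longrightarrow> y \<in> d (prefix r x))"
    if "x \<in> ?X" for x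
    unfolding d_def by (rule someI_ex) (use r[OF that] in blast)
  define E where "E n x = {y \<in> ?X. \<forall>i<n. (shift ^^ i) y \<in> d (prefix r ((shift ^^ i) x))}" for n x
  have "\<exists>\<V>\<subseteq>iterated_join (markov_space A) shift \<U> n.
      finite \<V> \<and> \<Union>\<V> = ?X \<and> card \<V> \<le> card (words A (n + r))" for n
  proof (intro exI[of _ "E n ` ?X"] conjI)
    show "E n ` ?X \<subseteq> iterated_join (markov_space A) shift \<U> n"
    proof
      fix V assume "V \<in> E n ` ?X"
      then obtain x where x: "x \<in> ?X" "V = E n x" by auto
      have "\<forall>i<n. d (prefix r ((shift ^^ i) x)) \<in> \<U>"
        using d shift_funpow_markov_sequences[OF x(1)] by blast
      then show "V \<in> iterated_join (markov_space A) shift \<U> n"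
        unfolding iterated_join_def x(2) E_def mem_Collect_eq topspace_markov_space
        by (intro exI[of _ "\<lambda>i. d (prefix r ((shift ^^ i) x))"]) simp
    qed
    have "x \<in> E n x" if "x \<in> ?X" for x
      using d shift_funpow_markov_sequences[OF that] that by (auto simp: E_def)
    then show "\<Union> (E n ` ?X) = ?X"
      by (auto simp: E_def)
    have "prefix r ((shift ^^ i) x) = prefix r ((shift ^^ i) y)"
      if "prefix (n + r) x = prefix (n + r) y" "i < n" for i and x y :: "nat \<Rightarrow> 'n"
      using that by (auto simp: prefix_eq_iff shift_funpow)
    then have "E n x = E n y" if "prefix (n + r) x = prefix (n + r) y" for x y
      unfolding E_def using that by (metis (no_types, lifting))
    with finite_words[of A "n + r"]
    have "finite (E n ` ?X) \<and> card (E n ` ?X) \<le> card (words A (n + r))"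
      unfolding words_def by (rule card_image_le_if_determined)
    then show "finite (E n ` ?X)" "card (E n ` ?X) \<le> card (words A (n + r))"
      by blast+
  qed
  then show ?thesis
    unfolding topspace_markov_space by blast
qed

lemma cover_number_attained:
  assumes "\<V> \<subseteq> \<U>" "finite \<V>" "\<Union>\<V> = topspace X"
  shows "\<exists>\<W>\<subseteq>\<U>. finite \<W> \<and> \<Union>\<W> = topspace X \<and> card \<W> = cover_number X \<U>"
  unfolding cover_number_def by (rule LeastI_ex) (use assms in blast)

lemma cover_number_le:
  assumes "\<V> \<subseteq> \<U>" "finite \<V>" "\<Union>\<V> = topspace X"
  shows "cover_number X \<U> \<le> card \<V>"
  unfolding cover_number_def by (rule Least_le) (use assms in blast)

lemma cover_entropy_le_word_entropy:
  fixes A :: "nat^'n^'n"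
  assumes "open_cover (markov_space A) \<U>"
  shows "cover_entropy (markov_space A) shift \<U> \<le> word_entropy A"
proof -
  let ?J = "iterated_join (markov_space A) shift \<U>"
  obtain r where r: "\<And>n. \<exists>\<V>\<subseteq>?J n.
      finite \<V> \<and> \<Union>\<V> = topspace (markov_space A) \<and> card \<V> \<le> card (words A (n + r))"
    using iterated_join_finite_subcover[OF assms] by blast
  \<comment> \<open>The trivial factor \<open>1 ^ (n div 1)\<close> gives the estimate the shape
    required by \<open>limsup_ln_growth_le\<close>.\<close>
  have "cover_number (markov_space A) (?J n) \<le> card (words A n) * (CARD('n) ^ r * 1 ^ (n div 1))" for n
  proof -
    have "cover_number (markov_space A) (?J n) \<le> card (words A (n + r))"
      using r[of n] cover_number_le[of _ "?J n" "markov_space A"] le_trans by blast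
    then show ?thesis
      using card_words_add_le[of A n r] by simp
  qed
  then have "limsup (\<lambda>n. ereal (ln (real (cover_number (markov_space A) (?J n))) / real n)) \<le>
      limsup (\<lambda>n. ereal (ln (real (card (words A n))) / real n)) + ereal (ln (real 1) / real 1)"
    by (rule limsup_ln_growth_le) (auto simp: Suc_le_eq)
  then show ?thesis
    by (simp add: cover_entropy_def word_entropy_def)
qed

lemma topological_entropy_markov_space:
  "topological_entropy (markov_space A) shift = word_entropy A"
proof (rule antisym)
  show "topological_entropy (markov_space A) shift \<le> word_entropy A"
    unfolding topological_entropy_def by (rule SUP_least) (simp add: cover_entropy_le_word_entropy)
next
  let ?X = "markov_sequences A"
  \<comment> \<open>The partition by the symbol at 0 attains the supremum: a member of its
    \<open>n\<close>-th join contains only points with one common prefix of length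
    \<open>n\<close>.\<close>
  define P where "P = range (\<lambda>a. {x \<in> topspace (markov_space A). x 0 \<in> {a}})"
  let ?J = "iterated_join (markov_space A) shift P"
  have cover: "open_cover (markov_space A) P"
    unfolding open_cover_def P_def
    using openin_continuous_map_preimage[OF continuous_map_coordinate[of A 0], of "{_}"] by auto
  have "card (words A n) \<le> cover_number (markov_space A) (?J n)" for n
  proof -
    obtain \<V> where \<V>: "\<V> \<subseteq> ?J n" "finite \<V>" "\<Union>\<V> = ?X"
        "card \<V> = cover_number (markov_space A) (?J n)"
      using iterated_join_finite_subcover[OF cover] cover_number_attained[of _ "?J n" "markov_space A"]
      by (metis topspace_markov_space)
    have same: "prefix n x = prefix n y" if V: "V \<in> ?J n" and "x \<in> V" "y \<in> V" for V x y
    proof -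
      obtain c where c: "V = {x \<in> ?X. \<forall>i<n. (shift ^^ i) x \<in> c i}" "\<forall>i<n. c i \<in> P"
        using V by (auto simp: iterated_join_def)
      have "x i = y i" if "i < n" for i
      proof -
        obtain a where "c i = {x \<in> topspace (markov_space A). x 0 \<in> {a}}"
          using c(2) \<open>i < n\<close> unfolding P_def by blast
        then have "(shift ^^ i) x 0 = a" "(shift ^^ i) y 0 = a"
          using \<open>x \<in> V\<close> \<open>y \<in> V\<close> c(1) that by auto
        then show ?thesis by (simp add: shift_funpow)
      qed
      then show ?thesis by (simp add: prefix_eq_iff)
    qed
    \<comment> \<open>A subcover needs a member for every word, since the word can be read off from
      any point of a member containing a representative.\<close>
    have "words A n \<subseteq> (\<lambda>V. prefix n (SOME x. x \<in> V)) ` \<V>"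
    proof
      fix w assume "w \<in> words A n"
      then obtain x where x: "x \<in> ?X" "w = prefix n x" by (auto simp: words_def)
      then obtain V where V: "V \<in> \<V>" "x \<in> V" using \<V>(3) by blast
      then have "w = prefix n (SOME x. x \<in> V)"
        using same[of V x "SOME x. x \<in> V"] \<V>(1) x(2) someI[of "\<lambda>x. x \<in> V" x] by blast
      then show "w \<in> (\<lambda>V. prefix n (SOME x. x \<in> V)) ` \<V>" using V by blast
    qed
    then show ?thesis
      using \<V> surj_card_le by metis
  qed
  then have "word_entropy A \<le> cover_entropy (markov_space A) shift P"
    unfolding word_entropy_def cover_entropy_def
    by (intro Limsup_mono always_eventually allI) (simp add: divide_right_mono ln_real_mono)
  also have "\<dots> \<le> topological_entropy (markov_space A) shift"
    unfolding topological_entropy_def using cover by (intro SUP_upper) simp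
  finally show "word_entropy A \<le> topological_entropy (markov_space A) shift" .
qed

section \<open>The factor map of a strong continuous orbit equivalence\<close>

lemma matrix_power_Suc_right: "matrix_power A (Suc n) = matrix_power A n ** A"
  by (induction n) (simp_all add: matrix_power_def matrix_mul_assoc del: One_nat_def)

text \<open>Irreducibility gives a closed path of positive length through \<open>y 0\<close>. Its
  last edge, isolated by writing the power as \<open>matrix_power A m ** A\<close>, starts at a
  symbol \<open>a\<close> that may precede \<open>y\<close>.\<close>

lemma shift_surj_markov_sequences:
  fixes A :: "nat^'n^'n"
  assumes "zero_one_matrix A" "irreducible_matrix A" "y \<in> markov_sequences A"
  shows "\<exists>x\<in>markov_sequences A. shift x = y"
proof -
  obtain n where "n > 0" "matrix_power A n $ y 0 $ y 0 > 0"
    using assms(2) by (auto simp: irreducible_matrix_def)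
  then obtain m where "(matrix_power A m ** A) $ y 0 $ y 0 > 0"
    using matrix_power_Suc_right by (metis gr0_implies_Suc)
  then have "(\<Sum>a\<in>UNIV. matrix_power A m $ y 0 $ a * A $ a $ y 0) \<noteq> 0"
    unfolding matrix_matrix_mult_def vec_lambda_beta by (rule gr_implies_not0)
  then obtain a where "matrix_power A m $ y 0 $ a * A $ a $ y 0 \<noteq> 0"
    by (rule sum.not_neutral_contains_not_neutral)
  then have "A $ a $ y 0 \<noteq> 0"
    by (metis mult_0_right)
  moreover have "A $ a $ y 0 \<in> {0, 1}"
    using assms(1) unfolding zero_one_matrix_def by (elim allE)
  ultimately have "A $ a $ y 0 = 1"
    by simp
  then have "case_nat a y \<in> markov_sequences A"
    using assms(3) by (auto simp: markov_sequences_def split: nat.split)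
  moreover have "shift (case_nat a y) = y"
    by (auto simp: shift_def)
  ultimately show ?thesis by blast
qed

lemma shift_funpow_surj_markov_sequences:
  assumes "zero_one_matrix A" "irreducible_matrix A" "y \<in> markov_sequences A"
  shows "\<exists>x\<in>markov_sequences A. (shift ^^ n) x = y"
proof (induction n)
  case (Suc n)
  then show ?case
    using shift_surj_markov_sequences[OF assms(1,2)] by (metis comp_apply funpow_Suc_right)
qed (use assms in auto)

text \<open>The cocycle identity says that \<open>t (shift x) - k1 x\<close> and
  \<open>t x + 1 - l1 x\<close> agree when \<open>t\<close> is \<open>b\<close> plus a constant.
  Shifting the orbit equation by this common amount gives exact equivariance.\<close>

lemma strong_coe_factor_map:
  fixes A :: "nat^'n^'n" and B :: "nat^'m^'m"
  assumes "strongly_continuously_orbit_equivalent A B"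
  obtains h g t J where
    "homeomorphic_maps (markov_space A) (markov_space B) h g"
    "continuous_map (markov_space A) (discrete_topology UNIV) t"
    "\<And>x. x \<in> markov_sequences A \<Longrightarrow> t x \<le> J"
    "\<And>x. x \<in> markov_sequences A \<Longrightarrow>
       (shift ^^ t (shift x)) (h (shift x)) = shift ((shift ^^ t x) (h x))"
proof -
  let ?X = "markov_sequences A"
  obtain h g k1 l1 k2 l2 b where coe: "coe_via A B h g k1 l1 k2 l2"
    and b: "continuous_map (markov_space A) (discrete_topology UNIV) b"
    and coc: "\<And>x. x \<in> ?X \<Longrightarrow> cocycle k1 l1 x = 1 + b x - b (shift x)"
    using assms unfolding strongly_continuously_orbit_equivalent_def by blast
  have k1: "continuous_map (markov_space A) (discrete_topology UNIV) k1"
    and orbit: "\<And>x. x \<in> ?X \<Longrightarrow> (shift ^^ k1 x) (h (shift x)) = (shift ^^ l1 x) (h x)"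
    using coe by (auto simp: coe_via_def)
  obtain K where K: "\<And>x. x \<in> ?X \<Longrightarrow> k1 x \<le> K"
    using finite_nat_set_iff_bounded_le[of "k1 ` ?X"] continuous_map_discrete_finite_image[OF k1]
    by auto
  obtain M where M: "\<And>x. x \<in> ?X \<Longrightarrow> \<bar>b x\<bar> \<le> M"
    using bdd_above_finite[OF finite_imageI[OF continuous_map_discrete_finite_image[OF b], of abs]]
    unfolding bdd_above_def by auto
  \<comment> \<open>Adding \<open>M\<close> makes \<open>M + b x\<close> nonnegative, so
    \<open>nat\<close> truncates nothing; adding \<open>K\<close> ensures
    \<open>t (shift x) \<ge> k1 x\<close>, so the subtraction defining \<open>d\<close> is
    exact.\<close>
  define t where "t x = nat (int K + M + b x)" for x
  show thesis
  proof (rule that[of h g t "nat (int K + 2 * M)"])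
    show "homeomorphic_maps (markov_space A) (markov_space B) h g"
      using coe by (simp add: coe_via_def)
    show "continuous_map (markov_space A) (discrete_topology UNIV) t"
      unfolding t_def
      using continuous_map_compose[OF b, of "discrete_topology UNIV" "\<lambda>z. nat (int K + M + z)"]
      by (simp add: o_def)
    fix x assume x: "x \<in> ?X"
    show "t x \<le> nat (int K + 2 * M)"
      using M[OF x] by (auto simp: t_def)
    define d where "d = t (shift x) - k1 x"
    have "t (shift x) = d + k1 x" "Suc (t x) = d + l1 x"
      using M[OF x] M[OF shift_markov_sequences[OF x]] K[OF x] coc[OF x]
      by (auto simp: d_def t_def cocycle_def)
    then show "(shift ^^ t (shift x)) (h (shift x)) = shift ((shift ^^ t x) (h x))"
      using orbit[OF x] by (metis comp_apply funpow.simps(2) funpow_add)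
  qed
qed

section \<open>The two inequalities between word entropies\<close>

theorem corollary1p2:
  fixes A :: "nat^'n^'n" and B :: "nat^'m^'m"
  assumes "CARD('n) > 1" and "CARD('m) > 1"
    and "zero_one_matrix A" and "zero_one_matrix B"
    and "irreducible_matrix A" and "irreducible_matrix B"
    and "\<not> permutation_matrix A" and "\<not> permutation_matrix B"
    and "strongly_continuously_orbit_equivalent A B"
  shows "topological_entropy (markov_space A) shift = topological_entropy (markov_space B) shift"
proof -
  let ?X = "markov_sequences A" and ?Y = "markov_sequences B"
  obtain h g t J where hg: "homeomorphic_maps (markov_space A) (markov_space B) h g"
    and t: "continuous_map (markov_space A) (discrete_topology UNIV) t"
    and J: "\<And>x. x \<in> ?X \<Longrightarrow> t x \<le> J"
    and equi: "\<And>x. x \<in> ?X \<Longrightarrow>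
       (shift ^^ t (shift x)) (h (shift x)) = shift ((shift ^^ t x) (h x))"
    using strong_coe_factor_map[OF assms(9)] by metis
  have cont_h: "continuous_map (markov_space A) (markov_space B) h"
    and cont_g: "continuous_map (markov_space B) (markov_space A) g"
    and gh: "\<And>x. x \<in> ?X \<Longrightarrow> g (h x) = x" and hg': "\<And>y. y \<in> ?Y \<Longrightarrow> h (g y) = y"
    using hg by (auto simp: homeomorphic_maps_def)
  have h: "h x \<in> ?Y" if "x \<in> ?X" for x
    using continuous_map_image_subset_topspace[OF cont_h] that by auto
  have g: "g y \<in> ?X" if "y \<in> ?Y" for y
    using continuous_map_image_subset_topspace[OF cont_g] that by auto
  define \<phi> where "\<phi> x = (shift ^^ t x) (h x)" for x
  have \<phi>: "\<phi> x \<in> ?Y" if "x \<in> ?X" for x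
    using h[OF that] by (simp add: \<phi>_def shift_funpow_markov_sequences)
  have \<phi>_shift: "\<phi> ((shift ^^ i) x) = (shift ^^ i) (\<phi> x)" if "x \<in> ?X" for x i
    using equi shift_funpow_markov_sequences[OF that]
    by (induction i) (simp_all add: \<phi>_def)
  have \<phi>_surj: "\<phi> ` ?X = ?Y"
  proof (intro equalityI subsetI)
    fix y assume "y \<in> ?Y"
    \<comment> \<open>The value of \<open>t\<close> at the eventual preimage is not known in
      advance, so \<open>y\<close> is pulled back by the uniform bound \<open>J\<close>;
      equivariance then supplies the missing \<open>J - t (g z)\<close> shifts.\<close>
    then obtain z where z: "z \<in> ?Y" "(shift ^^ J) z = y"
      using shift_funpow_surj_markov_sequences[OF assms(4,6)] by metis
    have gz: "g z \<in> ?X" using g z by simp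
    have "\<phi> ((shift ^^ (J - t (g z))) (g z)) = (shift ^^ (J - t (g z) + t (g z))) z"
      using \<phi>_shift[OF gz] hg'[OF z(1)] by (simp add: \<phi>_def funpow_add)
    also have "\<dots> = y" using J[OF gz] z(2) by simp
    finally show "y \<in> \<phi> ` ?X"
      using shift_funpow_markov_sequences[OF gz] by (metis image_eqI)
  qed (use \<phi> in auto)
  have "word_entropy B \<le> word_entropy A"
  proof -
    obtain s1 where s1: "\<forall>x\<in>?X. \<forall>y\<in>?X. prefix s1 x = prefix s1 y \<longrightarrow> t x = t y"
      using continuous_map_discrete_uniform[OF t] by blast
    obtain s2 where s2: "\<forall>x\<in>?X. \<forall>y\<in>?X. prefix s2 x = prefix s2 y \<longrightarrow>
        prefix (Suc J) (h x) = prefix (Suc J) (h y)"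
      using continuous_map_markov_space_uniform[OF cont_h] by blast
    define s where "s = max s1 s2"
    \<comment> \<open>The map \<open>\<phi>\<close> is a sliding block code:
      \<open>\<phi> x 0\<close> is \<open>h x (t x)\<close>, and \<open>t x \<le> J\<close> places
      this symbol within a prefix of length \<open>Suc J\<close>. Equivariance carries the rule to
      all positions.\<close>
    have local: "\<phi> x 0 = \<phi> y 0" if "x \<in> ?X" "y \<in> ?X" "prefix s x = prefix s y" for x y
    proof -
      have "prefix s1 x = prefix s1 y" "prefix s2 x = prefix s2 y"
        using prefix_eq_mono[OF that(3)] by (auto simp: s_def)
      then have "t x = t y" "prefix (Suc J) (h x) = prefix (Suc J) (h y)"
        using s1 s2 that(1,2) by blast+
      moreover from this have "h x (t x) = h y (t x)"
        using J[OF that(1)] unfolding prefix_eq_iff by (meson less_Suc_eq_le)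
      ultimately show ?thesis
        by (simp add: \<phi>_def shift_funpow)
    qed
    have "card (words B n) \<le> card (words A n) * (CARD('n) ^ s * 1 ^ (n div 1))" for n
    proof -
      have "prefix n (\<phi> x) = prefix n (\<phi> y)"
        if "x \<in> ?X" "y \<in> ?X" "prefix (n + s) x = prefix (n + s) y" for x y
        unfolding prefix_eq_iff
      proof (intro allI impI)
        fix i assume "i < n"
        then have "prefix s ((shift ^^ i) x) = prefix s ((shift ^^ i) y)"
          using that(3) by (auto simp: prefix_eq_iff shift_funpow)
        then have "\<phi> ((shift ^^ i) x) 0 = \<phi> ((shift ^^ i) y) 0"
          using that by (intro local shift_funpow_markov_sequences)
        then show "\<phi> x i = \<phi> y i"
          using \<phi>_shift that by (simp add: shift_funpow)
      qed
      with finite_words[of A "n + s"]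
      have "card ((\<lambda>x. prefix n (\<phi> x)) ` ?X) \<le> card (words A (n + s))"
        unfolding words_def by (rule card_image_le_if_determined[THEN conjunct2])
      moreover have "words B n = (\<lambda>x. prefix n (\<phi> x)) ` ?X"
        by (simp only: words_def \<phi>_surj[symmetric] image_image)
      ultimately have "card (words B n) \<le> card (words A (n + s))"
        by simp
      then show ?thesis
        using card_words_add_le[of A n s] by simp
    qed
    then have "word_entropy B \<le> word_entropy A + ereal (ln (real 1) / real 1)"
      unfolding word_entropy_def by (rule limsup_ln_growth_le) (auto simp: Suc_le_eq)
    then show ?thesis by simp
  qed
  moreover have "word_entropy A \<le> word_entropy B"
  proof -
    define S where "S = {..J} \<times> {xs :: 'm list. length xs = J}"
    define D where "D = card S"
    have fin_S: "finite S"
      by (simp add: S_def finite_lists_of_length)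
    have D: "D = Suc J * CARD('m) ^ J"
      by (simp add: D_def S_def card_cartesian_product card_lists_of_length)
    then have "D \<ge> 1"
      by (simp add: Suc_le_eq)
    text \<open>The number \<open>D\<close> of possible pairs \<open>(t x, prefix J (h x))\<close>, which together with
      \<open>\<phi> x\<close> determine \<open>x\<close>, does not depend on \<open>p\<close>.\<close>
    have bound: "word_entropy A \<le> word_entropy B + ereal (ln (real D) / real p)" if "p \<ge> 1" for p
    proof -
      \<comment> \<open>The window \<open>w\<close> may grow with \<open>p\<close>, but it will
        affect only the constant factor of the growth estimate.\<close>
      obtain w where w: "\<And>y z. y \<in> ?Y \<Longrightarrow> z \<in> ?Y \<Longrightarrow> prefix w y = prefix w z \<Longrightarrow>
          prefix p (g y) = prefix p (g z)"
        using continuous_map_markov_space_uniform[OF cont_g] by metis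
      define e where "e x = (t x, prefix J (h x))" for x
      have e: "e x \<in> S" if "x \<in> ?X" for x
        using J[OF that] by (auto simp: e_def S_def prefix_def)
      \<comment> \<open>The symbols of \<open>h x\<close> before \<open>J\<close> are recorded in
        \<open>e x\<close>; a later one is \<open>\<phi> x (i - t x)\<close>, with
        \<open>t x\<close> also recorded. Then \<open>g\<close> recovers \<open>x\<close> from
        \<open>h x\<close>.\<close>
      have block: "prefix p x = prefix p y"
        if "x \<in> ?X" "y \<in> ?X" "e x = e y" "prefix w (\<phi> x) = prefix w (\<phi> y)" for x y
      proof -
        have "h x i = h y i" if "i < w" for i
        proof (cases "i < J")
          case False
          then have "i - t x < w" "i - t x + t x = i"
            using J[OF \<open>x \<in> ?X\<close>] \<open>i < w\<close> by auto
          then show ?thesis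
            using \<open>e x = e y\<close> \<open>prefix w (\<phi> x) = prefix w (\<phi> y)\<close>
            by (auto simp: e_def \<phi>_def shift_funpow prefix_eq_iff)
        qed (use \<open>e x = e y\<close> in \<open>auto simp: e_def prefix_eq_iff\<close>)
        then show ?thesis
          using w[OF h h] that gh by (metis prefix_eq_iff)
      qed
      \<comment> \<open>Cut \<open>x\<close> into \<open>q\<close> blocks of length
        \<open>p\<close>. By equivariance one word of \<open>\<phi> x\<close> serves all blocks, so
        each block costs only one value of \<open>e\<close>, a factor \<open>D\<close>. The extra
        length \<open>w\<close> lets the window of the last block fit.\<close>
      have blocks: "card (words A (q * p)) \<le> card (words B (q * p + w)) * D ^ q" for q
      proof -
        let ?f = "\<lambda>x. (prefix (q * p + w) (\<phi> x), map (\<lambda>j. e ((shift ^^ (j * p)) x)) [0..<q])"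
        let ?R = "words B (q * p + w) \<times> {xs. set xs \<subseteq> S \<and> length xs = q}"
        have sub: "?f ` ?X \<subseteq> ?R"
        proof (rule image_subsetI)
          fix x assume "x \<in> ?X"
          then have "e ((shift ^^ i) x) \<in> S" for i
            by (intro e shift_funpow_markov_sequences)
          then show "?f x \<in> ?R"
            using \<phi>[OF \<open>x \<in> ?X\<close>] by (auto simp: words_def)
        qed
        have fin: "finite ?R"
          by (intro finite_cartesian_product finite_words finite_lists_length_eq fin_S)
        have "prefix (q * p) x = prefix (q * p) y"
          if "x \<in> ?X" "y \<in> ?X" and eq: "?f x = ?f y" for x y
          unfolding prefix_eq_iff
        proof (intro allI impI)
          fix i assume "i < q * p"
          define j where "j = i div p"
          have "j < q"
            using \<open>i < q * p\<close> by (simp add: j_def less_mult_imp_div_less)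
          have "i' + j * p < q * p + w" if "i' < w" for i'
            using that mult_le_mono1[of j q p] \<open>j < q\<close> by linarith
          then have "prefix w (\<phi> ((shift ^^ (j * p)) x)) = prefix w (\<phi> ((shift ^^ (j * p)) y))"
            using eq unfolding \<phi>_shift[OF that(1)] \<phi>_shift[OF that(2)]
            by (simp add: prefix_eq_iff shift_funpow)
          moreover have "e ((shift ^^ (j * p)) x) = e ((shift ^^ (j * p)) y)"
            using eq \<open>j < q\<close> by auto
          ultimately have "prefix p ((shift ^^ (j * p)) x) = prefix p ((shift ^^ (j * p)) y)"
            using that by (intro block shift_funpow_markov_sequences)
          moreover have "i mod p < p" "i mod p + j * p = i"
            using \<open>p \<ge> 1\<close> by (auto simp: j_def)
          ultimately show "x i = y i"
            by (auto simp: prefix_eq_iff shift_funpow)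
        qed
        then have "card (words A (q * p)) \<le> card (?f ` ?X)"
          unfolding words_def using finite_subset[OF sub fin]
          by (intro card_image_le_if_determined[THEN conjunct2]) blast+
        also have "\<dots> \<le> card ?R"
          by (rule card_mono[OF fin sub])
        also have "\<dots> = card (words B (q * p + w)) * D ^ q"
          by (simp add: card_cartesian_product card_lists_length_eq[OF fin_S] D_def)
        finally show ?thesis .
      qed
      have "card (words A n) \<le> card (words B n) * ((CARD('m) ^ (p + w) * D) * D ^ (n div p))" for n
      proof -
        \<comment> \<open>Rounding \<open>n\<close> up to a multiple of \<open>p\<close> costs one
          more factor \<open>D\<close> and, with the window, at most \<open>p + w\<close> further
          symbols.\<close>
        let ?q = "Suc (n div p)"
        have "n \<le> ?q * p" "?q * p + w \<le> n + (p + w)"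
          using \<open>p \<ge> 1\<close> by (simp_all add: less_imp_le_nat dividend_less_div_times)
        have mono: "card (words C a) \<le> card (words C b)" if "a \<le> b" for C :: "nat^'k^'k" and a b
          using finite_words[of C b] prefix_eq_mono[OF _ that] unfolding words_def
          by (rule card_image_le_if_determined[THEN conjunct2])
        have "card (words A n) \<le> card (words A (?q * p))"
          by (rule mono) fact
        also have "\<dots> \<le> card (words B (?q * p + w)) * D ^ ?q"
          by (rule blocks)
        also have "\<dots> \<le> card (words B (n + (p + w))) * D ^ ?q"
          by (intro mult_right_mono mono) (fact, simp)
        also have "\<dots> \<le> (card (words B n) * CARD('m) ^ (p + w)) * D ^ ?q"
          by (intro mult_right_mono card_words_add_le) simp
        finally show ?thesis
          by (simp add: mult_ac)
      qed
      then show ?thesis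
        unfolding word_entropy_def
        by (rule limsup_ln_growth_le) (use \<open>D \<ge> 1\<close> that in \<open>auto simp: Suc_le_eq\<close>)
    qed
    show ?thesis
    \<comment> \<open>Since \<open>D\<close> is independent of the block length, long blocks make
      the error \<open>ln D / p\<close> arbitrarily small; \<open>Suc p\<close> keeps the length
      positive.\<close>
    proof (rule ereal_le_epsilon2)
      fix \<epsilon> :: real assume "\<epsilon> > 0"
      obtain p :: nat where p: "ln (real D) / \<epsilon> < real p"
        using reals_Archimedean2 by blast
      have "ln (real D) / real (Suc p) \<le> \<epsilon>"
        using p \<open>\<epsilon> > 0\<close> by (simp add: field_simps)
      then have "word_entropy B + ereal (ln (real D) / real (Suc p)) \<le> word_entropy B + ereal \<epsilon>"
        by (intro add_left_mono) simp
      then show "word_entropy A \<le> word_entropy B + ereal \<epsilon>"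
        using bound[of "Suc p"] by (auto intro: order_trans)
    qed
  qed
  ultimately show ?thesis
    by (simp add: topological_entropy_markov_space)
qed

end
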